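(* For every even integer $\ell\ge 4$, there exists an obtuse lattice triangle of lattice perimeter $\ell$ whose circumcenter is a lattice point, and there exists a right lattice triangle of lattice perimeter $\ell$ whose circumcenter is a lattice point.
   Context: A lattice point is an element of $\mathbb Z^2\subseteq\mathbb R^2$. A lattice triangle is a (nondegenerate) triangle in $\mathbb R^2$ whose three vertices are lattice points. The lattice length of a segment joining two lattice points is the number of lattice points on the segment (endpoints included) minus one. The lattice perimeter of a lattice triangle is the sum of the lattice lengths of its three sides. A triangle is obtuse (respectively right) if one of its interior angles is strictly greater than (respectively equal to) $\pi/2$. *)

theory Defs
  imports "HOL-Analysis.Analysis"
begin

definition lattice_point :: "real^2 \<Rightarrow> bool" where
  "lattice_point p \<longleftrightarrow> (\<forall>i. p $ i \<in> \<int>)"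

definition lattice_triangle :: "real^2 \<Rightarrow> real^2 \<Rightarrow> real^2 \<Rightarrow> bool" where
  "lattice_triangle A B C \<longleftrightarrow>
     lattice_point A \<and> lattice_point B \<and> lattice_point C \<and> \<not> collinear {A, B, C}"

(* The counted set is finite and contains A for lattice points A and B, so that
   neither card nor the subtraction on nat is degenerate. *)
definition lattice_length :: "real^2 \<Rightarrow> real^2 \<Rightarrow> nat" where
  "lattice_length A B = card {p \<in> closed_segment A B. lattice_point p} - 1"

definition lattice_perimeter :: "real^2 \<Rightarrow> real^2 \<Rightarrow> real^2 \<Rightarrow> nat" where
  "lattice_perimeter A B C = lattice_length A B + lattice_length B C + lattice_length C A"

(* The interior angle at the middle argument B, in radians. *)
definition interior_angle :: "real^2 \<Rightarrow> real^2 \<Rightarrow> real^2 \<Rightarrow> real" where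
  "interior_angle A B C = arccos (((A - B) \<bullet> (C - B)) / (norm (A - B) * norm (C - B)))"

definition obtuse_triangle :: "real^2 \<Rightarrow> real^2 \<Rightarrow> real^2 \<Rightarrow> bool" where
  "obtuse_triangle A B C \<longleftrightarrow>
     interior_angle C A B > pi / 2 \<or> interior_angle A B C > pi / 2 \<or> interior_angle B C A > pi / 2"

definition right_triangle :: "real^2 \<Rightarrow> real^2 \<Rightarrow> real^2 \<Rightarrow> bool" where
  "right_triangle A B C \<longleftrightarrow>
     interior_angle C A B = pi / 2 \<or> interior_angle A B C = pi / 2 \<or> interior_angle B C A = pi / 2"

(* For a nondegenerate triangle in the plane there is exactly one such point Z. *)
definition is_circumcenter :: "real^2 \<Rightarrow> real^2 \<Rightarrow> real^2 \<Rightarrow> real^2 \<Rightarrow> bool" where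
  "is_circumcenter Z A B C \<longleftrightarrow> dist Z A = dist Z B \<and> dist Z B = dist Z C"

end

theory Submission
  imports Defs
begin

(* Both families have vertices B = (0,0) and C = (-1,1).  The third vertex is (l - 2, 0) in the
   obtuse case, with edge lengths l - 2, 1, 1, and (l - 3) (1,1) in the right case, with edge
   lengths l - 3, 1, 2; here l even makes the circumcenter integral. *)

lemma lattice_point_vector_iff:
  "lattice_point (vector [x, y]) \<longleftrightarrow> x \<in> \<int> \<and> y \<in> \<int>"
  by (simp add: lattice_point_def forall_2)

text \<open>A primitive direction \<open>v\<close> has no properly fractional multiple with integer
  coordinates, so the lattice points of the segment are exactly the \<open>n + 1\<close> points
  \<open>A + k v\<close> with \<open>k = 0, ..., n\<close>. This reduces every side length below to
  finding the primitive direction of the side.\<close>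

lemma lattice_length_multiple_of_primitive:
  fixes A :: "real^2" and p q :: int and n :: nat
  assumes A: "lattice_point A" and pq: "coprime p q"
    and B: "B = A + real n *\<^sub>R vector [of_int p, of_int q]"
  shows "lattice_length A B = n"
proof -
  let ?v = "vector [of_int p, of_int q] :: real^2"
  \<comment> \<open>Coprimality excludes \<open>p = q = 0\<close>, because gcd(0, 0) = 0. This later
    makes the \<open>n + 1\<close> points distinct.\<close>
  have v0: "?v \<noteq> 0"
    using pq by (auto simp: vec_eq_iff forall_2)
  have "{r \<in> closed_segment A B. lattice_point r} = (\<lambda>k. A + real k *\<^sub>R ?v) ` {0..n}"
  proof (intro equalityI subsetI)
    fix r assume "r \<in> {r \<in> closed_segment A B. lattice_point r}"
    then obtain t where t: "0 \<le> t" "t \<le> 1" "r = (1 - t) *\<^sub>R A + t *\<^sub>R B" and r: "lattice_point r"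
      by (auto simp: closed_segment_def)
    define s where "s = t * real n"
    have rs: "r = A + s *\<^sub>R ?v"
      by (simp add: t(3) B s_def algebra_simps)
    have "(r - A) $ 1 \<in> \<int>" "(r - A) $ 2 \<in> \<int>"
      using r A by (auto simp: lattice_point_def)
    then have sp: "s * of_int p \<in> \<int>" and sq: "s * of_int q \<in> \<int>"
      by (auto simp: rs)
    \<comment> \<open>Multiplying a Bezout identity by \<open>s\<close> writes \<open>s\<close> as
      an integer combination of the integers \<open>s * p\<close> and \<open>s * q\<close>.\<close>
    obtain a b where "a * p + b * q = 1"
      using pq by (metis bezout_int coprime_imp_gcd_eq_1)
    then have "of_int a * of_int p + of_int b * of_int q = (1::real)"
      by (metis of_int_1 of_int_add of_int_mult)
    then have "s = of_int a * (s * of_int p) + of_int b * (s * of_int q)"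
      by (metis distrib_left mult.left_commute mult.right_neutral)
    then have "s \<in> \<int>"
      using sp sq by (metis Ints_add Ints_mult Ints_of_int)
    moreover have "0 \<le> s" "s \<le> real n"
      using t by (auto simp: s_def mult_left_le_one_le)
    ultimately obtain k :: nat where "s = real k" "k \<le> n"
      by (metis Ints_cases nat_0_le of_int_0_le_iff of_int_of_nat_eq of_nat_le_iff)
    then show "r \<in> (\<lambda>k. A + real k *\<^sub>R ?v) ` {0..n}"
      by (auto simp: rs)
  next
    fix r assume "r \<in> (\<lambda>k. A + real k *\<^sub>R ?v) ` {0..n}"
    then obtain k where k: "k \<le> n" "r = A + real k *\<^sub>R ?v"
      by auto
    \<comment> \<open>For \<open>n = 0\<close> the quotient is 0 by convention, and the identity
      still holds since \<open>k = 0\<close> and \<open>r = A\<close>.\<close>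
    have "r = (1 - real k / real n) *\<^sub>R A + (real k / real n) *\<^sub>R B"
      using k by (cases "n = 0") (auto simp: B algebra_simps)
    then have "r \<in> closed_segment A B"
      using k(1) by (auto simp: closed_segment_def divide_le_eq intro!: exI[of _ "real k / real n"])
    moreover have "lattice_point r"
      using A by (auto simp: k(2) lattice_point_def forall_2)
    ultimately show "r \<in> {r \<in> closed_segment A B. lattice_point r}"
      by simp
  qed
  moreover have "inj_on (\<lambda>k. A + real k *\<^sub>R ?v) {0..n}"
    using v0 by (auto simp: inj_on_def)
  ultimately show ?thesis
    by (simp add: lattice_length_def card_image)
qed

text \<open>\<open>arccos\<close> is strictly decreasing on [-1, 1] with
  \<open>arccos 0 = pi / 2\<close>. Cauchy-Schwarz supplies the lower bound -1 for the
  cosine.\<close>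

lemma interior_angle_obtuse:
  assumes "(A - B) \<bullet> (C - B) < 0"
  shows "interior_angle A B C > pi / 2"
proof -
  \<comment> \<open>A side of length zero would make the inner product 0 rather than
    negative.\<close>
  have pos: "0 < norm (A - B) * norm (C - B)"
    using assms by (intro mult_pos_pos) auto
  have "- (norm (A - B) * norm (C - B)) \<le> (A - B) \<bullet> (C - B)"
    using Cauchy_Schwarz_ineq2[of "A - B" "C - B"] by linarith
  then have "-1 \<le> (A - B) \<bullet> (C - B) / (norm (A - B) * norm (C - B))"
    using pos by (simp add: le_divide_eq)
  moreover have "(A - B) \<bullet> (C - B) / (norm (A - B) * norm (C - B)) < 0"
    using assms pos by (simp add: divide_neg_pos)
  ultimately have "arccos 0 < interior_angle A B C"
    unfolding interior_angle_def by (intro arccos_less_arccos) auto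
  then show ?thesis by simp
qed

text \<open>The hypothesis says that the determinant of the two edge vectors at the origin is
  nonzero. The origin stands in the middle to match the vertex order \<open>A\<close>,
  \<open>B = 0\<close>, \<open>C\<close>.\<close>

lemma not_collinear_origin:
  fixes x y u v :: real
  assumes "x * v \<noteq> y * u"
  shows "\<not> collinear {vector [x, y] :: real^2, 0, vector [u, v]}"
proof
  assume "collinear {vector [x, y] :: real^2, 0, vector [u, v]}"
  then have "collinear {0, vector [x, y] :: real^2, vector [u, v]}"
    by (simp add: insert_commute)
  then show False
    using assms by (auto simp: collinear_lemma vec_eq_iff forall_2)
qed

text \<open>The angle at \<open>B\<close> is 135 degrees. The perpendicular bisectors of
  \<open>AB\<close> and \<open>BC\<close> are the lines x = a and y = x + 1, which meet at
  \<open>Z\<close>.\<close>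

lemma obtuse_lattice_triangle_exists:
  assumes "a > 0"
  shows "\<exists>A B C. lattice_triangle A B C \<and> obtuse_triangle A B C \<and> lattice_perimeter A B C = 2 * a + 2
            \<and> (\<exists>Z. is_circumcenter Z A B C \<and> lattice_point Z)"
proof -
  define A B C Z :: "real^2" where "A = vector [2 * real a, 0]" and "B = 0"
    and "C = vector [-1, 1]" and "Z = vector [real a, real a + 1]"
  have lat: "lattice_point A" "lattice_point B" "lattice_point C" "lattice_point Z"
    by (simp_all add: A_def B_def C_def Z_def lattice_point_vector_iff)
      (simp add: lattice_point_def)
  have "lattice_triangle A B C"
    using not_collinear_origin[of "2 * real a" 1 0 "-1"] assms lat
    by (simp add: lattice_triangle_def A_def B_def C_def)
  moreover have "obtuse_triangle A B C"
  proof -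
    have "interior_angle A B C > pi / 2"
      using assms by (intro interior_angle_obtuse)
        (simp add: A_def B_def C_def inner_vec_def sum_2)
    then show ?thesis by (simp add: obtuse_triangle_def)
  qed
  moreover have "lattice_perimeter A B C = 2 * a + 2"
  proof -
    have "lattice_length A B = 2 * a"
      by (rule lattice_length_multiple_of_primitive[of _ "-1" 0])
        (auto simp: lat, simp add: A_def B_def vec_eq_iff forall_2)
    moreover have "lattice_length B C = 1"
      by (rule lattice_length_multiple_of_primitive[of _ "-1" 1])
        (auto simp: lat, simp add: B_def C_def vec_eq_iff forall_2)
    \<comment> \<open>The edge vector \<open>A - C\<close> = (2a + 1, -1) is itself primitive,
      having an entry -1.\<close>
    moreover have "lattice_length C A = 1"
      by (rule lattice_length_multiple_of_primitive[of _ "2 * int a + 1" "-1"])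
        (auto simp: lat, simp add: A_def C_def vec_eq_iff forall_2)
    ultimately show ?thesis by (simp add: lattice_perimeter_def)
  qed
  moreover have "is_circumcenter Z A B C"
    by (simp add: is_circumcenter_def A_def B_def C_def Z_def dist_vec_def L2_set_def sum_2
        dist_real_def power2_eq_square algebra_simps)
  ultimately show ?thesis using lat by blast
qed

text \<open>The directions (1, 1) and (-1, 1) are perpendicular, so the right angle is at
  \<open>B\<close> and the circumcenter \<open>Z\<close> is the midpoint of the hypotenuse
  \<open>CA\<close>. It is integral because the coordinate \<open>2 * a + 1\<close> of
  \<open>A\<close> is odd.\<close>

lemma right_lattice_triangle_exists:
  "\<exists>A B C. lattice_triangle A B C \<and> right_triangle A B C \<and> lattice_perimeter A B C = 2 * a + 4
            \<and> (\<exists>Z. is_circumcenter Z A B C \<and> lattice_point Z)"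
proof -
  define A B C Z :: "real^2" where "A = vector [2 * real a + 1, 2 * real a + 1]" and "B = 0"
    and "C = vector [-1, 1]" and "Z = vector [real a, real a + 1]"
  have lat: "lattice_point A" "lattice_point B" "lattice_point C" "lattice_point Z"
    by (simp_all add: A_def B_def C_def Z_def lattice_point_vector_iff)
      (simp add: lattice_point_def)
  have "lattice_triangle A B C"
    using not_collinear_origin[of "2 * real a + 1" 1 "2 * real a + 1" "-1"] lat
    by (simp add: lattice_triangle_def A_def B_def C_def)
  moreover have "right_triangle A B C"
    by (simp add: right_triangle_def interior_angle_def A_def B_def C_def inner_vec_def sum_2)
  moreover have "lattice_perimeter A B C = 2 * a + 4"
  proof -
    have "lattice_length A B = 2 * a + 1"
      by (rule lattice_length_multiple_of_primitive[of _ "-1" "-1"])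
        (auto simp: lat, simp add: A_def B_def vec_eq_iff forall_2)
    moreover have "lattice_length B C = 1"
      by (rule lattice_length_multiple_of_primitive[of _ "-1" 1])
        (auto simp: lat, simp add: B_def C_def vec_eq_iff forall_2)
    \<comment> \<open>Here \<open>A - C\<close> = 2 (a + 1, a), and consecutive integers are
      coprime.\<close>
    moreover have "lattice_length C A = 2"
      by (rule lattice_length_multiple_of_primitive[of _ "int a + 1" "int a"])
        (auto simp: lat, simp add: A_def C_def vec_eq_iff forall_2)
    ultimately show ?thesis by (simp add: lattice_perimeter_def)
  qed
  moreover have "is_circumcenter Z A B C"
    by (simp add: is_circumcenter_def A_def B_def C_def Z_def dist_vec_def L2_set_def sum_2
        dist_real_def power2_eq_square algebra_simps)
  ultimately show ?thesis using lat by blast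
qed

theorem mainTheorem5:
  fixes l :: nat
  assumes "even l" and "l \<ge> 4"
  shows "(\<exists>A B C. lattice_triangle A B C \<and> obtuse_triangle A B C \<and> lattice_perimeter A B C = l
            \<and> (\<exists>Z. is_circumcenter Z A B C \<and> lattice_point Z))
       \<and> (\<exists>A B C. lattice_triangle A B C \<and> right_triangle A B C \<and> lattice_perimeter A B C = l
            \<and> (\<exists>Z. is_circumcenter Z A B C \<and> lattice_point Z))"
proof -
  obtain m where "l = 2 * m" using assms(1) by (rule evenE)
  \<comment> \<open>Since \<open>m\<close> is at least 2, neither natural subtraction truncates; for
    \<open>l = 4\<close> the right family is used at parameter 0.\<close>
  with assms(2) have "m - 1 > 0" "l = 2 * (m - 1) + 2" "l = 2 * (m - 2) + 4"
    by auto
  then show ?thesis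
    using obtuse_lattice_triangle_exists[of "m - 1"] right_lattice_triangle_exists[of "m - 2"]
    by metis
qed

end
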